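(* Let $\mathcal{X}$ be a separable Banach space, let $K\in L(\mathcal{X})$ have closed range, let $\{m_n\}$ be an increasing sequence of positive integers, and let $(\{x_n\},\{h_{n,i}\}_{n\in\mathbb{N},\,1\le i\le m_n})$ be an approximative $K$-atomic decomposition for $\mathcal{X}$ with respect to a BK-space $\mathcal{X}_d$, with bounds $A$ and $B$. Let $T\in L(\mathcal{X})$ with $\|T\|\neq 0$, and let $T^*$ be its adjoint on $\mathcal{X}^*$. Then $(\{x_n\},\{T^*h_{n,i}\}_{n\in\mathbb{N},\,1\le i\le m_n})$ is an approximative $KT$-atomic decomposition for $\mathcal{X}$ with respect to $\mathcal{X}_d$ with bounds $A$ and $B\|T\|$.
   Context: Scalars are $\mathbb{R}$ or $\mathbb{C}$. $L(\mathcal{X})$ is the space of bounded linear operators on $\mathcal{X}$, and $\mathcal{X}^*$ is the dual space. Given an increasing sequence $\{m_n\}_{n\in\mathbb{N}}$ of positive integers, a BK-space $\mathcal{X}_d$ here is a Banach space whose elements are scalar families $\{c_{n,i}\}_{n\in\mathbb{N},\,1\le i\le m_n}$ (with coordinatewise linear operations) and on which every coordinate functional is continuous. Definition. For any $K\in L(\mathcal{X})$, $\{x_n\}\subset\mathcal{X}$, and $\{h_{n,i}\}_{n\in\mathbb{N},\,1\le i\le m_n}\subset\mathcal{X}^*$, the pair $(\{x_n\},\{h_{n,i}\})$ is an approximative $K$-atomic decomposition for $\mathcal{X}$ with respect to $\mathcal{X}_d$ if: (a) $\{h_{n,i}(x)\}_{n\in\mathbb{N},1\le i\le m_n}\in\mathcal{X}_d$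 for all $x\in\mathcal{X}$; (b) there exist constants $A$ and $B$ with $0<A\le B<\infty$ such that $A\|K(x)\|_{\mathcal{X}}\le \|\{h_{n,i}(x)\}\|_{\mathcal{X}_d}\le B\|x\|_{\mathcal{X}}$ for all $x\in\mathcal{X}$; (c) for all $x\in\mathcal{X}$ the limit $\lim_{n\to\infty}\sum_{i=1}^{m_n}h_{n,i}(x)x_i$ exists in $\mathcal{X}$ and equals $K(x)$. The constants $A$ and $B$ in (b) are called lower and upper bounds of the approximative $K$-atomic decomposition.
   Formalization: The ordering A ≤ B‖T‖, part of the definition of bounds, is not claimed for the new pair since it can fail (K = I, A = B = 1, T = I/2); both inequalities with A and B‖T‖ are proved, and condition (b) holds with some ordered constants. *)

theory Defs
  imports "HOL-Analysis.Analysis" "HOL-Library.Function_Algebras"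
begin

text \<open>
  The scalars form a type of class \<open>real_normed_field\<close>: by the Gelfand--Mazur theorem these are, up to
  isometric isomorphism, exactly the real and the complex numbers. A Banach space over such a
  field is a type of class \<open>banach\<close> (which carries the norm, its completeness and the underlying
  real structure) together with a scalar multiplication that extends the real one.
\<close>

locale banach_over = vector_space smul
  for smul :: "'k::real_normed_field \<Rightarrow> 'a::banach \<Rightarrow> 'a" +
  assumes scale_of_real: "smul (of_real r) x = r *\<^sub>R x"
    and norm_scale: "norm (smul a x) = norm a * norm x"

definition bounded_operator ::
    "('k::real_normed_field \<Rightarrow> 'a::banach \<Rightarrow> 'a) \<Rightarrow> ('a \<Rightarrow> 'a) \<Rightarrow> bool" where
  "bounded_operator smul T \<longleftrightarrow> Vector_Spaces.linear smul smul T \<and> bounded_linear T"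

definition bounded_functional ::
    "('k::real_normed_field \<Rightarrow> 'a::banach \<Rightarrow> 'a) \<Rightarrow> ('a \<Rightarrow> 'k) \<Rightarrow> bool" where
  "bounded_functional smul f \<longleftrightarrow> Vector_Spaces.linear smul (*) f \<and> bounded_linear f"

definition dual_adjoint :: "('a::banach \<Rightarrow> 'a) \<Rightarrow> ('a \<Rightarrow> 'k::real_normed_field) \<Rightarrow> ('a \<Rightarrow> 'k)" where
  "dual_adjoint T f = f \<circ> T"

text \<open>
  A scalar family indexed by the pairs \<open>(n, i)\<close> with \<open>1 \<le> i \<le> m n\<close> is represented by a function on
  all pairs of natural numbers that is zero off the index set. Numbering \<open>n\<close> from 0 is only a
  relabelling; the index \<open>i\<close>, which is shared with the sequence of vectors, starts at 1.
\<close>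

definition family_scale :: "'k::real_normed_field \<Rightarrow> (nat \<times> nat \<Rightarrow> 'k) \<Rightarrow> (nat \<times> nat \<Rightarrow> 'k)" where
  "family_scale a c = (\<lambda>p. a * c p)"

lemma vector_space_family_scale: "vector_space family_scale"
  by unfold_locales (auto simp: family_scale_def fun_eq_iff algebra_simps)

locale normed_family_space =
  fixes Xd :: "(nat \<times> nat \<Rightarrow> 'k::real_normed_field) set"
    and nrm :: "(nat \<times> nat \<Rightarrow> 'k) \<Rightarrow> real"
  assumes subspace: "module.subspace family_scale Xd"
    and nrm_nonneg: "c \<in> Xd \<Longrightarrow> 0 \<le> nrm c"
    and nrm_eq_0_iff: "c \<in> Xd \<Longrightarrow> nrm c = 0 \<longleftrightarrow> c = 0"
    and nrm_triangle: "c \<in> Xd \<Longrightarrow> d \<in> Xd \<Longrightarrow> nrm (c + d) \<le> nrm c + nrm d"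
    and nrm_scale: "c \<in> Xd \<Longrightarrow> nrm (family_scale a c) = norm a * nrm c"

text \<open>The locale \<open>Metric_space\<close> wants a nonnegative symmetric distance also off the carrier, where
  \<open>nrm\<close> is arbitrary; hence the case distinction.\<close>

definition family_dist ::
    "(nat \<times> nat \<Rightarrow> 'k::real_normed_field) set \<Rightarrow> ((nat \<times> nat \<Rightarrow> 'k) \<Rightarrow> real) \<Rightarrow>
      (nat \<times> nat \<Rightarrow> 'k) \<Rightarrow> (nat \<times> nat \<Rightarrow> 'k) \<Rightarrow> real" where
  "family_dist Xd nrm c d = (if c \<in> Xd \<and> d \<in> Xd then nrm (c - d) else 0)"

lemma (in normed_family_space) Metric_space_family_dist: "Metric_space Xd (family_dist Xd nrm)"
proof -
  interpret F: vector_space family_scale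
    by (rule vector_space_family_scale)
  have diff: "c - d \<in> Xd" if "c \<in> Xd" "d \<in> Xd" for c d
    using F.subspace_diff[OF subspace that] .
  have sym: "nrm (c - d) = nrm (d - c)" if "c \<in> Xd" "d \<in> Xd" for c d
  proof -
    have "c - d = family_scale (- 1) (d - c)"
      by (auto simp: family_scale_def)
    then show ?thesis
      using nrm_scale[OF diff[OF that(2,1)], of "- 1"] by simp
  qed
  have tri: "nrm (c - e) \<le> nrm (c - d) + nrm (d - e)" if "c \<in> Xd" "d \<in> Xd" "e \<in> Xd" for c d e
    using nrm_triangle[OF diff[OF that(1,2)] diff[OF that(2,3)]] by simp
  show ?thesis
    by unfold_locales
      (auto simp: family_dist_def diff nrm_nonneg nrm_eq_0_iff sym tri)
qed

locale bk_space = normed_family_space Xd nrm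
  for m :: "nat \<Rightarrow> nat"
    and Xd :: "(nat \<times> nat \<Rightarrow> 'k::real_normed_field) set"
    and nrm :: "(nat \<times> nat \<Rightarrow> 'k) \<Rightarrow> real" +
  assumes supported: "c \<in> Xd \<Longrightarrow> i \<notin> {1..m n} \<Longrightarrow> c (n, i) = 0"
    and complete: "Metric_space.mcomplete Xd (family_dist Xd nrm)"
    and continuous_coordinate: "i \<in> {1..m n} \<Longrightarrow>
      continuous_map (Metric_space.mtopology Xd (family_dist Xd nrm)) euclidean (\<lambda>c. c (n, i))"

definition coefficients ::
    "(nat \<Rightarrow> nat) \<Rightarrow> (nat \<Rightarrow> nat \<Rightarrow> 'a::banach \<Rightarrow> 'k::real_normed_field) \<Rightarrow> 'a \<Rightarrow> (nat \<times> nat \<Rightarrow> 'k)" where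
  "coefficients m h y = (\<lambda>(n, i). if i \<in> {1..m n} then h n i y else 0)"

text \<open>
  \<open>A\<close> is a lower and \<open>B\<close> an upper bound. The normalisation \<open>A \<le> B\<close> of the constants is not part of
  this predicate but of the existence requirement in the definition of a decomposition below:
  it can always be arranged there by decreasing \<open>A\<close>, but need not hold for a given pair of valid
  bounds (the operator may vanish, or be small relative to the coefficients).
\<close>

definition decomposition_bounds ::
    "(nat \<Rightarrow> nat) \<Rightarrow> ((nat \<times> nat \<Rightarrow> 'k::real_normed_field) \<Rightarrow> real) \<Rightarrow> ('a::banach \<Rightarrow> 'a) \<Rightarrow>
      (nat \<Rightarrow> nat \<Rightarrow> 'a \<Rightarrow> 'k) \<Rightarrow> real \<Rightarrow> real \<Rightarrow> bool" where
  "decomposition_bounds m nrm K h A B \<longleftrightarrow> 0 < A \<and> 0 < B \<and>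
    (\<forall>y. A * norm (K y) \<le> nrm (coefficients m h y) \<and> nrm (coefficients m h y) \<le> B * norm y)"

definition approximative_atomic_decomposition ::
    "('k::real_normed_field \<Rightarrow> 'a::banach \<Rightarrow> 'a) \<Rightarrow> (nat \<Rightarrow> nat) \<Rightarrow>
      (nat \<times> nat \<Rightarrow> 'k) set \<Rightarrow> ((nat \<times> nat \<Rightarrow> 'k) \<Rightarrow> real) \<Rightarrow> ('a \<Rightarrow> 'a) \<Rightarrow>
      (nat \<Rightarrow> 'a) \<Rightarrow> (nat \<Rightarrow> nat \<Rightarrow> 'a \<Rightarrow> 'k) \<Rightarrow> bool" where
  "approximative_atomic_decomposition smul m Xd nrm K x h \<longleftrightarrow>
    bounded_operator smul K \<and>
    (\<forall>n. \<forall>i\<in>{1..m n}. bounded_functional smul (h n i)) \<and>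
    (\<forall>y. coefficients m h y \<in> Xd) \<and>
    (\<exists>A B. A \<le> B \<and> decomposition_bounds m nrm K h A B) \<and>
    (\<forall>y. (\<lambda>n. \<Sum>i = 1..m n. smul (h n i y) (x i)) \<longlonglongrightarrow> K y)"

end

theory Submission
  imports Defs
begin

text \<open>
  Since \<open>(T\<^sup>* h)(y) = h (T y)\<close>, the coefficient family of \<open>y\<close> with respect to the functionals
  \<open>T\<^sup>* h\<close> is the coefficient family of \<open>T y\<close> with respect to \<open>h\<close>. Membership in the sequence space,
  the lower bound and the reconstruction limit for \<open>K \<circ> T\<close> at \<open>y\<close> are therefore the corresponding
  properties for \<open>K\<close> at \<open>T y\<close>. Only the upper bound sees \<open>T\<close> itself, through
  \<open>B * norm (T y) \<le> B * onorm T * norm y\<close>; the new constant is positive because \<open>T\<close> is nonzero.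
\<close>

lemma bounded_operator_comp:
  assumes "bounded_operator smul K" "bounded_operator smul T"
  shows "bounded_operator smul (K \<circ> T)"
  using assms Vector_Spaces.linear_compose[of smul smul T smul K] bounded_linear_compose[of K T]
  by (simp add: bounded_operator_def o_def)

lemma bounded_functional_dual_adjoint:
  assumes "bounded_functional smul f" "bounded_operator smul T"
  shows "bounded_functional smul (dual_adjoint T f)"
  using assms Vector_Spaces.linear_compose[of smul smul T "(*)" f] bounded_linear_compose[of f T]
  by (simp add: bounded_operator_def bounded_functional_def dual_adjoint_def o_def)

lemma coefficients_dual_adjoint:
  "coefficients m (\<lambda>n i. dual_adjoint T (h n i)) y = coefficients m h (T y)"
  by (simp add: coefficients_def dual_adjoint_def cong: if_cong)

lemma decomposition_bounds_dual_adjoint: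
  assumes bounds: "decomposition_bounds m nrm K h A B"
    and T: "bounded_linear T" "onorm T \<noteq> 0"
  shows "decomposition_bounds m nrm (K \<circ> T) (\<lambda>n i. dual_adjoint T (h n i)) A (B * onorm T)"
proof -
  have pos: "0 < A" "0 < B"
    and lower: "A * norm (K z) \<le> nrm (coefficients m h z)"
    and upper: "nrm (coefficients m h z) \<le> B * norm z" for z
    using bounds by (auto simp: decomposition_bounds_def)
  have "0 < onorm T"
    using onorm_pos_le[OF T(1)] T(2) by simp
  moreover have "nrm (coefficients m h (T y)) \<le> B * onorm T * norm y" for y
  proof -
    have "nrm (coefficients m h (T y)) \<le> B * norm (T y)"
      by (rule upper)
    also have "\<dots> \<le> B * (onorm T * norm y)"
      using onorm[OF T(1), of y] pos by (simp add: mult_left_mono)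
    finally show ?thesis
      by (simp add: mult.assoc)
  qed
  ultimately show ?thesis
    using pos lower by (simp add: decomposition_bounds_def coefficients_dual_adjoint)
qed

text \<open>
  Composing with an operator of small norm can push the upper constant \<open>B * onorm T\<close> below \<open>A\<close>. The
  existence requirement in the definition of a decomposition asks for ordered constants, which
  shrinking the lower one provides.
\<close>

lemma decomposition_bounds_ordered:
  assumes "decomposition_bounds m nrm K h A B"
  shows "\<exists>A' B'. A' \<le> B' \<and> decomposition_bounds m nrm K h A' B'"
proof (intro exI conjI)
  show "min A B \<le> B"
    by simp
  have "min A B * norm (K y) \<le> A * norm (K y)" for y
    by (simp add: mult_right_mono)
  then show "decomposition_bounds m nrm K h (min A B) B"
    using assms by (auto simp: decomposition_bounds_def intro: order_trans)
qed

theorem theorem2p9: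
  fixes smul :: "'k::real_normed_field \<Rightarrow> 'a::banach \<Rightarrow> 'a"
    and m :: "nat \<Rightarrow> nat"
    and Xd :: "(nat \<times> nat \<Rightarrow> 'k) set"
    and nrm :: "(nat \<times> nat \<Rightarrow> 'k) \<Rightarrow> real"
    and K T :: "'a \<Rightarrow> 'a"
    and x :: "nat \<Rightarrow> 'a"
    and h :: "nat \<Rightarrow> nat \<Rightarrow> 'a \<Rightarrow> 'k"
    and A B :: real
  assumes "banach_over smul"
    and "separable_space (euclidean :: 'a topology)"
    and "bounded_operator smul K"
    and "closed (range K)"
    and "incseq m"
    and "\<forall>n. 0 < m n"
    and "bk_space m Xd nrm"
    and "approximative_atomic_decomposition smul m Xd nrm K x h"
    and "A \<le> B"
    and "decomposition_bounds m nrm K h A B"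
    and "bounded_operator smul T"
    and "onorm T \<noteq> 0"
  shows "approximative_atomic_decomposition smul m Xd nrm (K \<circ> T) x (\<lambda>n i. dual_adjoint T (h n i))
    \<and> decomposition_bounds m nrm (K \<circ> T) (\<lambda>n i. dual_adjoint T (h n i)) A (B * onorm T)"
proof -
  note dec = assms(8)[unfolded approximative_atomic_decomposition_def]
  have T: "bounded_linear T"
    using assms(11) by (simp add: bounded_operator_def)
  have bounds: "decomposition_bounds m nrm (K \<circ> T) (\<lambda>n i. dual_adjoint T (h n i)) A (B * onorm T)"
    using decomposition_bounds_dual_adjoint[OF assms(10) T assms(12)] .
  have "bounded_operator smul (K \<circ> T)"
    using bounded_operator_comp[OF assms(3,11)] .
  moreover have "\<forall>n. \<forall>i\<in>{1..m n}. bounded_functional smul (dual_adjoint T (h n i))"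
    using dec bounded_functional_dual_adjoint[OF _ assms(11)] by blast
  moreover have "\<forall>y. coefficients m (\<lambda>n i. dual_adjoint T (h n i)) y \<in> Xd"
    using dec by (simp add: coefficients_dual_adjoint)
  moreover have "\<forall>y. (\<lambda>n. \<Sum>i = 1..m n. smul (dual_adjoint T (h n i) y) (x i))
      \<longlonglongrightarrow> (K \<circ> T) y"
    using dec by (simp add: dual_adjoint_def)
  ultimately show ?thesis
    using bounds decomposition_bounds_ordered[OF bounds]
    unfolding approximative_atomic_decomposition_def by blast
qed

end
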